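(* Let $G(x,c)$ be the optimal policy function for transaction cost $c$ (the decision boundary when the current position is long). For small transaction costs it has the first-order approximation $$G(x,c)=-\frac{\rho_0}{\rho_1}x+\frac{\partial G}{\partial c}(x,0)\,c+o(c),$$ where $$\frac{\partial G}{\partial c}(x,0)=-\frac1{2\rho_1}+\frac{1}{2\rho_0\rho_1}\Big[H\big(\tfrac{\rho_1}{\rho_0}x,0\big)-H\big(-\tfrac{\rho_1}{\rho_0}x,0\big)\Big]f\big(\tfrac{\rho_1}{\rho_0}x\big)-\frac{x}{\rho_0}f\big(\tfrac{\rho_1}{\rho_0}x\big)-\frac1{2\rho_1}\int_{-\frac{\rho_1}{\rho_0}x}^{\frac{\rho_1}{\rho_0}x}f(y)\,dy$$ and $$H(x,0)=\rho_0x+\rho_1x\int_{-\frac{\rho_1}{\rho_0}x}^{\frac{\rho_1}{\rho_0}x}f(y)\,dy-2\rho_0\int_0^{\frac{\rho_1}{\rho_0}x}yf(y)\,dy.$$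
   Context: Here $f(y)=\frac1{\sqrt{2\pi}}e^{-y^2/2}$. The setting is the average-reward Markov decision process with states $(x_0,x_1,q)\in\mathbb{R}\times\mathbb{R}\times\{1,-1\}$ (current signal, previous signal, current position), choice of new position $q'\in\{1,-1\}$ at each step, reward $(\rho_0x_0+\rho_1x_1)q'-c\,\mathbf 1_{\{q'\ne q\}}$ with constants $\rho_0,\rho_1$ and switching cost $c\ge0$, and next state $(\omega,x_0,q')$ with $\omega$ a fresh standard Gaussian. The optimal policy when $q=1$ is to be long iff $x_1\ge G(x_0,c)$. The function $H(x,c)$ is the part of the bias function $h$ (the solution of the Bellman equation) depending on the current signal: for $q=1$, $h(x_0,x_1,1)=\rho_1x_1+H(x_0,c)$ in the region where the policy is to be long. $H$ and $G$ are viewed as functions of the independent variables $x$ and $c$, $G^{-1}(\cdot,c)$ denotes the inverse in $x$ only, and they satisfy $$H(x,c)=\rho_0\Big(x+\frac{c}{2\rho_1}\Big)+\rho_1x\int_{G^{-1}(x,c)}^{-G^{-1}(x,c)}f(y)\,dy+\Big(\int_{G^{-1}(x,c)}^{0}-\int_{0}^{-G^{-1}(x,c)}\Big)H(y,c)f(y)\,dy-c\int_0^{-G^{-1}(x,c)}f(y)\,dy,$$ $$G(x,c)=-\frac{\rho_0}{\rho_1}x-\frac{c}{2\rho_1}+\frac1{2\rho_1}\Big(\int_{G^{-1}(-x,c)}^{G^{-1}(-x-\frac c{\rho_1},c)}-\int_{G^{-1}(x,c)}^{G^{-1}(x-\frac c{\rho_1},c)}\Big)H(y,c)f(y)\,dy-x\int_{G^{-1}(x,c)}^{G^{-1}(x-\frac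 c{\rho_1},c)}f(y)\,dy-\frac c{2\rho_1}\int_{G^{-1}(x,c)}^{G^{-1}(-x,c)}f(y)\,dy.$$ *)

theory Defs
  imports "HOL-Probability.Probability"
begin

definition std_gaussian :: "real measure" where
  "std_gaussian = density lborel (\<lambda>y. ennreal (std_normal_density y))"

text \<open>A state is (current signal, previous signal, current position).\<close>

type_synonym state = "real \<times> real \<times> int"

definition positions :: "int set" where
  "positions = {1, -1}"

definition states :: "state set" where
  "states = UNIV \<times> UNIV \<times> positions"

fun reward :: "real \<Rightarrow> real \<Rightarrow> real \<Rightarrow> state \<Rightarrow> int \<Rightarrow> real" where
  "reward \<rho>0 \<rho>1 c (x0, x1, q) q' =
     (\<rho>0 * x0 + \<rho>1 * x1) * real_of_int q' - (if q' \<noteq> q then c else 0)"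

fun next_state :: "state \<Rightarrow> int \<Rightarrow> real \<Rightarrow> state" where
  "next_state (x0, x1, q) q' w = (w, x0, q')"

text \<open>Right-hand side of the Bellman equation before maximising over the new position \<open>q'\<close>.\<close>

definition action_value ::
  "real \<Rightarrow> real \<Rightarrow> real \<Rightarrow> (state \<Rightarrow> real) \<Rightarrow> state \<Rightarrow> int \<Rightarrow> real" where
  "action_value \<rho>0 \<rho>1 c h s q' =
     reward \<rho>0 \<rho>1 c s q' + (\<integral>w. h (next_state s q' w) \<partial>std_gaussian)"

text \<open>The average-reward Bellman equation. The constant \<open>g\<close> is the gain. The equation
  leaves an additive constant in \<open>h\<close> free, so results about values of \<open>h\<close> need a normalization.\<close>

definition bias_function :: "real \<Rightarrow> real \<Rightarrow> real \<Rightarrow> (state \<Rightarrow> real) \<Rightarrow> bool" where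
  "bias_function \<rho>0 \<rho>1 c h \<longleftrightarrow>
     (\<forall>x. \<forall>q\<in>positions. integrable std_gaussian (\<lambda>w. h (w, x, q))) \<and>
     (\<exists>g. \<forall>s\<in>states. h s + g = Max (action_value \<rho>0 \<rho>1 c h s ` positions))"

definition policy :: "(state \<Rightarrow> int) \<Rightarrow> bool" where
  "policy \<pi> \<longleftrightarrow>
     (\<forall>q\<in>positions. (\<lambda>(x0, x1). \<pi> (x0, x1, q)) \<in> borel \<rightarrow>\<^sub>M count_space positions)"

primrec total_reward ::
  "real \<Rightarrow> real \<Rightarrow> real \<Rightarrow> (state \<Rightarrow> int) \<Rightarrow> nat \<Rightarrow> state \<Rightarrow> real" where
  "total_reward \<rho>0 \<rho>1 c \<pi> 0 s = 0"
| "total_reward \<rho>0 \<rho>1 c \<pi> (Suc n) s = reward \<rho>0 \<rho>1 c s (\<pi> s) +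
     (\<integral>w. total_reward \<rho>0 \<rho>1 c \<pi> n (next_state s (\<pi> s) w) \<partial>std_gaussian)"

definition average_optimal :: "real \<Rightarrow> real \<Rightarrow> real \<Rightarrow> (state \<Rightarrow> int) \<Rightarrow> bool" where
  "average_optimal \<rho>0 \<rho>1 c \<pi> \<longleftrightarrow> policy \<pi> \<and>
     (\<forall>\<pi>' s. policy \<pi>' \<longrightarrow> s \<in> states \<longrightarrow>
        limsup (\<lambda>n. ereal (total_reward \<rho>0 \<rho>1 c \<pi>' n s / real n))
        \<le> liminf (\<lambda>n. ereal (total_reward \<rho>0 \<rho>1 c \<pi> n s / real n)))"

text \<open>The long-run average alone does not see changes of the policy on null sets; the decision at
  every single state is pinned down by the Bellman equation.\<close>

definition optimal_policy ::
  "real \<Rightarrow> real \<Rightarrow> real \<Rightarrow> (state \<Rightarrow> real) \<Rightarrow> (state \<Rightarrow> int) \<Rightarrow> bool" where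
  "optimal_policy \<rho>0 \<rho>1 c h \<pi> \<longleftrightarrow> average_optimal \<rho>0 \<rho>1 c \<pi> \<and>
     (\<forall>s\<in>states. action_value \<rho>0 \<rho>1 c h s (\<pi> s)
        = Max (action_value \<rho>0 \<rho>1 c h s ` positions))"

text \<open>The claimed value of the derivative of \<open>G\<close> in \<open>c\<close> at \<open>(x, 0)\<close>, where \<open>H0 y\<close> stands for
  \<open>H(y, 0)\<close>. Interval integrals with exchanged bounds are negated, as in the usual oriented
  convention.\<close>

definition boundary_slope :: "real \<Rightarrow> real \<Rightarrow> (real \<Rightarrow> real) \<Rightarrow> real \<Rightarrow> real" where
  "boundary_slope \<rho>0 \<rho>1 H0 x =
     - 1 / (2 * \<rho>1)
     + 1 / (2 * \<rho>0 * \<rho>1) * (H0 (\<rho>1 / \<rho>0 * x) - H0 (- (\<rho>1 / \<rho>0 * x)))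
         * std_normal_density (\<rho>1 / \<rho>0 * x)
     - x / \<rho>0 * std_normal_density (\<rho>1 / \<rho>0 * x)
     - 1 / (2 * \<rho>1)
         * (LBINT y = - (\<rho>1 / \<rho>0 * x)..\<rho>1 / \<rho>0 * x. std_normal_density y)"

end

theory Submission
  imports Defs
begin

text \<open>
  Fix the cost \<open>c\<close> and let \<open>K x\<close> be the advantage, after a signal \<open>x\<close>, of entering the next
  period long rather than short, that is the difference of the two continuation values. Two
  remarks make the problem explicit.

  On the one hand, the long position is kept exactly when \<open>2 (\<rho>0 x0 + \<rho>1 x1) + K x0 \<ge> -c\<close>, so that
  \<open>G x c = - (\<rho>0 / \<rho>1) x - c / (2 \<rho>1) - K x / (2 \<rho>1)\<close>. On the other hand, subtracting the Bellman
  equations of the two positions leaves, for a signal \<open>w\<close> that follows \<open>x\<close>, the quantity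
  \<open>2 (\<rho>0 w + \<rho>1 x) + K w\<close> truncated to \<open>[-c, c]\<close>: holding the right position is never worth more
  than the cost of acquiring it. Hence \<open>K\<close> solves the fixed point equation
  \<open>K x = E (clamp c (2 (\<rho>0 w + \<rho>1 x) + K w))\<close>, and in particular \<open>\<bar>K\<bar> \<le> c\<close>.

  For small \<open>c\<close> the truncated quantity is therefore \<open>c\<close> times the sign of \<open>\<rho>0 w + \<rho>1 x\<close>, except when
  \<open>\<bar>\<rho>0 w + \<rho>1 x\<bar> \<le> c\<close>, an event of probability \<open>O(c)\<close>. With \<open>a = \<rho>1 x / \<rho>0\<close> this gives
  \<open>K x = c E (sgn (w + a)) + O(c\<^sup>2)\<close>, and the expected sign is the Gaussian mass of the oriented
  interval from \<open>-a\<close> to \<open>a\<close>. The slope of \<open>G\<close> in \<open>c\<close> is thus \<open>-1 / (2 \<rho>1)\<close> minus that mass divided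
  by \<open>2 \<rho>1\<close>.

  For \<open>c = 0\<close> the advantage vanishes and the Bellman equation integrates to
  \<open>H x 0 = \<rho>0 x + E \<bar>\<rho>0 w + \<rho>1 x\<bar> - E \<bar>\<rho>0 w\<bar>\<close>, whence the formula for \<open>H\<close>. Its last two terms are even in
  \<open>x\<close>, so \<open>H y 0 - H (-y) 0 = 2 \<rho>0 y\<close>; at \<open>y = a\<close> this makes the two terms of \<open>boundary_slope\<close> that
  carry the density cancel each other.
\<close>

section \<open>Expectations under the standard Gaussian\<close>

lemma prob_space_std_gaussian: "prob_space std_gaussian"
  unfolding std_gaussian_def by (rule prob_space_normal_density) simp

lemma sets_std_gaussian [simp, measurable_cong]: "sets std_gaussian = sets borel"
  by (simp add: std_gaussian_def)

lemma space_std_gaussian [simp]: "space std_gaussian = UNIV"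
  by (simp add: std_gaussian_def)

lemma integral_std_gaussian:
  fixes g :: "real \<Rightarrow> real"
  assumes [measurable]: "g \<in> borel_measurable borel"
  shows "(\<integral>w. g w \<partial>std_gaussian) = (\<integral>w. std_normal_density w * g w \<partial>lborel)"
  unfolding std_gaussian_def by (subst integral_density) auto

lemma integral_std_gaussian_reflect:
  fixes g :: "real \<Rightarrow> real"
  assumes [measurable]: "g \<in> borel_measurable borel"
  shows "(\<integral>w. g (- w) \<partial>std_gaussian) = (\<integral>w. g w \<partial>std_gaussian)"
proof -
  have "(\<integral>w. std_normal_density w * g w \<partial>lborel)
      = (\<integral>w. std_normal_density (- w) * g (- w) \<partial>lborel)"
    using lborel_integral_real_affine[of "-1" "\<lambda>w. std_normal_density w * g w" 0] by simp
  then show ?thesis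
    by (simp add: integral_std_gaussian normal_density_def)
qed

lemma integrable_std_gaussian_affine:
  fixes b a :: real
  shows "integrable std_gaussian (\<lambda>w. b * w + a)"
proof -
  interpret prob_space std_gaussian by (rule prob_space_std_gaussian)
  have "integrable std_gaussian (\<lambda>w. w)"
    using integrable_std_normal_moment[of 1]
    unfolding std_gaussian_def by (subst integrable_density) auto
  then show ?thesis by auto
qed

lemma integrable_std_gaussian_sgn: "integrable std_gaussian (\<lambda>w. sgn (b * w + a :: real))"
proof -
  interpret prob_space std_gaussian by (rule prob_space_std_gaussian)
  show ?thesis
    by (rule integrable_const_bound[of _ 1]) (auto simp: sgn_if)
qed

text \<open>The bound is crude: the density is replaced by \<open>1\<close>. Only the linear rate in \<open>r\<close> matters for
  the remainder below.\<close>

lemma measure_std_gaussian_cball_le: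
  assumes "r \<ge> 0"
  shows "measure std_gaussian (cball a r) \<le> 2 * r"
proof -
  have le1: "std_normal_density w \<le> 1" for w
  proof -
    have "1 \<le> sqrt (2 * pi)"
      using pi_gt3 by simp
    moreover have "exp (- w\<^sup>2 / 2) \<le> 1" by simp
    ultimately have "1 / sqrt (2 * pi) * exp (- w\<^sup>2 / 2) \<le> 1 * 1"
      by (intro mult_mono) (auto simp: divide_le_eq)
    then show ?thesis by (simp add: std_normal_density_def)
  qed
  have "emeasure std_gaussian (cball a r)
      = (\<integral>\<^sup>+ w. ennreal (std_normal_density w) * indicator (cball a r) w \<partial>lborel)"
    by (simp add: std_gaussian_def emeasure_density)
  also have "\<dots> \<le> (\<integral>\<^sup>+ w. indicator (cball a r) w \<partial>lborel)"
    by (intro nn_integral_mono) (auto simp: indicator_def le1)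
  also have "\<dots> = ennreal (2 * r)"
    using assms by (simp add: cball_eq_atLeastAtMost)
  finally show ?thesis
    using assms by (simp add: measure_def enn2real_leI)
qed

text \<open>Averaging over \<open>w\<close> and \<open>-w\<close> turns the sign of \<open>w + a\<close> into the indicator of
  \<open>\<bar>w\<bar> < a\<close>, up to the endpoints.\<close>

lemma expectation_sgn_nonneg:
  assumes "a \<ge> 0"
  shows "(\<integral>w. sgn (w + a) \<partial>std_gaussian) = (LBINT y = - a..a. std_normal_density y)"
proof -
  have sym: "(\<integral>w. sgn (- w + a) \<partial>std_gaussian) = (\<integral>w. sgn (w + a) \<partial>std_gaussian)"
    by (rule integral_std_gaussian_reflect) simp
  have "(\<integral>w. sgn (w + a) \<partial>std_gaussian)
      = (\<integral>w. (sgn (w + a) + sgn (- w + a)) / 2 \<partial>std_gaussian)"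
    using sym integrable_std_gaussian_sgn[of 1 a] integrable_std_gaussian_sgn[of "-1" a] by simp
  also have "\<dots> = (\<integral>w. std_normal_density w * ((sgn (w + a) + sgn (- w + a)) / 2) \<partial>lborel)"
    by (rule integral_std_gaussian) simp
  also have "\<dots> = (\<integral>w. indicator {-a<..<a} w * std_normal_density w \<partial>lborel)"
  proof (rule integral_cong_AE)
    show "AE w in lborel. std_normal_density w * ((sgn (w + a) + sgn (- w + a)) / 2)
        = indicator {-a<..<a} w * std_normal_density w"
      using AE_lborel_singleton[of a] AE_lborel_singleton[of "-a"]
    proof eventually_elim
      case (elim w)
      then show ?case using assms by (auto simp: sgn_if indicator_def)
    qed
  qed auto
  also have "\<dots> = (LBINT y = - a..a. std_normal_density y)"
    using assms by (simp add: interval_lebesgue_integral_def set_lebesgue_integral_def)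
  finally show ?thesis .
qed

lemma expectation_sgn:
  "(\<integral>w. sgn (w + a) \<partial>std_gaussian) = (LBINT y = - a..a. std_normal_density y)"
proof (cases "a \<ge> 0")
  case False
  have "(\<integral>w. sgn (w + a) \<partial>std_gaussian) = (\<integral>w. sgn (- w + a) \<partial>std_gaussian)"
    by (rule integral_std_gaussian_reflect[symmetric]) simp
  also have "\<dots> = (\<integral>w. - sgn (w + (- a)) \<partial>std_gaussian)"
    by (simp flip: sgn_minus)
  also have "\<dots> = - (LBINT y = - (- a)..- a. std_normal_density y)"
    using expectation_sgn_nonneg[of "- a"] False by simp
  also have "\<dots> = (LBINT y = - a..a. std_normal_density y)"
    by (subst interval_integral_endpoints_reverse) simp
  finally show ?thesis .
qed (rule expectation_sgn_nonneg)

lemma interval_integrable_continuous: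
  fixes f :: "real \<Rightarrow> real" and a b :: real
  assumes "continuous_on UNIV f"
  shows "interval_lebesgue_integrable lborel a b f"
  using assms by (intro interval_integrable_isCont) (simp add: continuous_on_eq_continuous_at)

lemma continuous_std_normal_density [continuous_intros]:
  "continuous_on S std_normal_density"
  unfolding std_normal_density_def by (intro continuous_intros) auto

text \<open>The same averaging turns \<open>\<bar>w + a\<bar>\<close> into \<open>max \<bar>w\<bar> a\<close>.\<close>

lemma expectation_abs_nonneg:
  assumes "a \<ge> 0"
  shows "(\<integral>w. \<bar>w + a\<bar> \<partial>std_gaussian) - (\<integral>w. \<bar>w\<bar> \<partial>std_gaussian)
    = a * (LBINT y = - a..a. std_normal_density y)
      - 2 * (LBINT y = 0..a. y * std_normal_density y)"
proof -
  let ?f = "std_normal_density"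
  have int: "integrable std_gaussian (\<lambda>w. \<bar>b * w + d\<bar>)" for b d
    by (rule integrable_abs[OF integrable_std_gaussian_affine])
  have sym: "(\<integral>w. \<bar>- w + a\<bar> \<partial>std_gaussian) = (\<integral>w. \<bar>w + a\<bar> \<partial>std_gaussian)"
    by (rule integral_std_gaussian_reflect) simp
  have "(\<integral>w. \<bar>w + a\<bar> \<partial>std_gaussian) - (\<integral>w. \<bar>w\<bar> \<partial>std_gaussian)
      = (\<integral>w. (\<bar>w + a\<bar> + \<bar>- w + a\<bar>) / 2 - \<bar>w\<bar> \<partial>std_gaussian)"
    using sym int[of 1 a] int[of "-1" a] int[of 1 0] by simp
  also have "\<dots> = (\<integral>w. ?f w * ((\<bar>w + a\<bar> + \<bar>- w + a\<bar>) / 2 - \<bar>w\<bar>) \<partial>lborel)"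
    by (rule integral_std_gaussian) simp
  also have "\<dots> = (\<integral>w. indicator {-a<..<a} w * (a * ?f w - \<bar>w\<bar> * ?f w) \<partial>lborel)"
  proof (intro Bochner_Integration.integral_cong refl)
    fix w
    have "(\<bar>w + a\<bar> + \<bar>- w + a\<bar>) / 2 - \<bar>w\<bar> = indicator {-a<..<a} w * (a - \<bar>w\<bar>)"
      using assms by (auto simp: indicator_def abs_if)
    then show "?f w * ((\<bar>w + a\<bar> + \<bar>- w + a\<bar>) / 2 - \<bar>w\<bar>)
        = indicator {-a<..<a} w * (a * ?f w - \<bar>w\<bar> * ?f w)"
      by (simp only:) (simp add: algebra_simps)
  qed
  also have "\<dots> = (LBINT y = - a..a. a * ?f y - \<bar>y\<bar> * ?f y)"
    using assms by (simp add: interval_lebesgue_integral_def set_lebesgue_integral_def)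
  also have "\<dots> = (LBINT y = - a..a. a * ?f y) - (LBINT y = - a..a. \<bar>y\<bar> * ?f y)"
    by (intro interval_lebesgue_integral_diff interval_integrable_continuous continuous_intros)
  also have "(LBINT y = - a..a. a * ?f y) = a * (LBINT y = - a..a. ?f y)"
    by simp
  also have "(LBINT y = - a..a. \<bar>y\<bar> * ?f y)
      = (LBINT y = - a..0. \<bar>y\<bar> * ?f y) + (LBINT y = 0..a. \<bar>y\<bar> * ?f y)"
  proof (rule interval_integral_sum[symmetric])
    have "min (ereal (- a)) (min 0 (ereal a)) = ereal (- a)"
      "max (ereal (- a)) (max 0 (ereal a)) = ereal a"
      using assms by (auto simp: min_def max_def)
    then show "interval_lebesgue_integrable lborel (min (ereal (- a)) (min 0 (ereal a)))
        (max (ereal (- a)) (max 0 (ereal a))) (\<lambda>y. \<bar>y\<bar> * ?f y)"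
      by (simp only:) (intro interval_integrable_continuous continuous_intros)
  qed
  also have "(LBINT y = - a..0. \<bar>y\<bar> * ?f y) = (LBINT y = 0..a. \<bar>y\<bar> * ?f y)"
    by (subst interval_integral_reflect) (simp add: normal_density_def)
  also have "(LBINT y = 0..a. \<bar>y\<bar> * ?f y) = (LBINT y = 0..a. y * ?f y)"
    using assms by (intro interval_integral_cong) (auto simp: einterval_def zero_ereal_def)
  finally show ?thesis by simp
qed

lemma interval_integral_id_std_normal_even:
  fixes a :: real
  shows "(LBINT y = 0..- a. y * std_normal_density y) = (LBINT y = 0..a. y * std_normal_density y)"
proof -
  have "(LBINT y = 0..- a. y * std_normal_density y)
      = (LBINT y = a..0. - y * std_normal_density (- y))"
    by (subst interval_integral_reflect) simp
  also have "\<dots> = - (LBINT y = 0..a. - y * std_normal_density (- y))"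
    by (rule interval_integral_endpoints_reverse)
  also have "\<dots> = (LBINT y = 0..a. y * std_normal_density y)"
    by (simp add: normal_density_def interval_lebesgue_integral_uminus)
  finally show ?thesis .
qed

lemma interval_integral_std_normal_odd:
  fixes a :: real
  shows "(LBINT y = - (- a)..- a. std_normal_density y) = - (LBINT y = - a..a. std_normal_density y)"
  by (subst interval_integral_endpoints_reverse) simp

lemma expectation_abs:
  "(\<integral>w. \<bar>w + a\<bar> \<partial>std_gaussian) - (\<integral>w. \<bar>w\<bar> \<partial>std_gaussian)
    = a * (LBINT y = - a..a. std_normal_density y)
      - 2 * (LBINT y = 0..a. y * std_normal_density y)"
proof (cases "a \<ge> 0")
  case False
  have "(\<integral>w. \<bar>w + a\<bar> \<partial>std_gaussian) = (\<integral>w. \<bar>- w + a\<bar> \<partial>std_gaussian)"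
    by (rule integral_std_gaussian_reflect[symmetric]) simp
  also have "\<dots> = (\<integral>w. \<bar>w + (- a)\<bar> \<partial>std_gaussian)"
    by (intro Bochner_Integration.integral_cong) auto
  finally show ?thesis
    using expectation_abs_nonneg[of "- a"] False
      interval_integral_std_normal_odd[of a] interval_integral_id_std_normal_even[of a]
    by simp
qed (rule expectation_abs_nonneg)

section \<open>The advantage of being long\<close>

definition continuation_value :: "(state \<Rightarrow> real) \<Rightarrow> real \<Rightarrow> int \<Rightarrow> real" where
  "continuation_value h x q = (\<integral>w. h (w, x, q) \<partial>std_gaussian)"

definition long_advantage :: "(state \<Rightarrow> real) \<Rightarrow> real \<Rightarrow> real" where
  "long_advantage h x = continuation_value h x 1 - continuation_value h x (- 1)"

definition clamp_cost :: "real \<Rightarrow> real \<Rightarrow> real" where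
  "clamp_cost c t = max (- c) (min c t)"

lemma action_value_eq:
  "action_value \<rho>0 \<rho>1 c h (x0, x1, q) q' =
     (\<rho>0 * x0 + \<rho>1 * x1) * real_of_int q' - (if q' \<noteq> q then c else 0) + continuation_value h x0 q'"
  by (simp add: action_value_def continuation_value_def)

lemma bellman_equations:
  assumes "bias_function \<rho>0 \<rho>1 c h"
  obtains g where
    "\<And>x0 x1. h (x0, x1, 1) + g
       = max (\<rho>0 * x0 + \<rho>1 * x1 + continuation_value h x0 1)
             (- (\<rho>0 * x0 + \<rho>1 * x1) - c + continuation_value h x0 (- 1))"
    "\<And>x0 x1. h (x0, x1, - 1) + g
       = max (\<rho>0 * x0 + \<rho>1 * x1 - c + continuation_value h x0 1)
             (- (\<rho>0 * x0 + \<rho>1 * x1) + continuation_value h x0 (- 1))"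
proof -
  from assms obtain g where
    g: "\<And>s. s \<in> states \<Longrightarrow> h s + g = Max (action_value \<rho>0 \<rho>1 c h s ` positions)"
    by (auto simp: bias_function_def)
  show thesis
  proof (rule that)
    show "h (x0, x1, 1) + g
       = max (\<rho>0 * x0 + \<rho>1 * x1 + continuation_value h x0 1)
             (- (\<rho>0 * x0 + \<rho>1 * x1) - c + continuation_value h x0 (- 1))" for x0 x1
      using g[of "(x0, x1, 1)"] by (simp add: states_def positions_def action_value_eq)
    show "h (x0, x1, - 1) + g
       = max (\<rho>0 * x0 + \<rho>1 * x1 - c + continuation_value h x0 1)
             (- (\<rho>0 * x0 + \<rho>1 * x1) + continuation_value h x0 (- 1))" for x0 x1
      using g[of "(x0, x1, - 1)"] by (simp add: states_def positions_def action_value_eq)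
  qed
qed

lemma integrable_bias:
  assumes "bias_function \<rho>0 \<rho>1 c h" "q \<in> positions"
  shows "integrable std_gaussian (\<lambda>w. h (w, x, q))"
  using assms by (auto simp: bias_function_def)

text \<open>The optimal continuation is common to both positions up to the switching cost, so the
  value of being long instead of short is the unconstrained gain cut off at \<open>\<plusminus>c\<close>.\<close>

lemma bias_difference:
  assumes "bias_function \<rho>0 \<rho>1 c h" "c \<ge> 0"
  shows "h (x0, x1, 1) - h (x0, x1, - 1)
    = clamp_cost c (2 * (\<rho>0 * x0 + \<rho>1 * x1) + long_advantage h x0)"
proof -
  obtain g where
    "h (x0, x1, 1) + g
       = max (\<rho>0 * x0 + \<rho>1 * x1 + continuation_value h x0 1)
             (- (\<rho>0 * x0 + \<rho>1 * x1) - c + continuation_value h x0 (- 1))"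
    "h (x0, x1, - 1) + g
       = max (\<rho>0 * x0 + \<rho>1 * x1 - c + continuation_value h x0 1)
             (- (\<rho>0 * x0 + \<rho>1 * x1) + continuation_value h x0 (- 1))"
    using bellman_equations[OF assms(1)] by metis
  then show ?thesis
    using assms(2) unfolding clamp_cost_def long_advantage_def max_def min_def
    by (auto split: if_splits)
qed

lemma long_advantage_fixed_point:
  assumes "bias_function \<rho>0 \<rho>1 c h" "c \<ge> 0"
  shows "integrable std_gaussian
           (\<lambda>w. clamp_cost c (2 * (\<rho>0 * w + \<rho>1 * x) + long_advantage h w))"
    and "long_advantage h x
       = (\<integral>w. clamp_cost c (2 * (\<rho>0 * w + \<rho>1 * x) + long_advantage h w) \<partial>std_gaussian)"
proof -
  have int: "integrable std_gaussian (\<lambda>w. h (w, x, 1))"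
    "integrable std_gaussian (\<lambda>w. h (w, x, - 1))"
    by (rule integrable_bias[OF assms(1)], simp add: positions_def)+
  then show "integrable std_gaussian
      (\<lambda>w. clamp_cost c (2 * (\<rho>0 * w + \<rho>1 * x) + long_advantage h w))"
    unfolding bias_difference[OF assms, symmetric] by simp
  show "long_advantage h x
       = (\<integral>w. clamp_cost c (2 * (\<rho>0 * w + \<rho>1 * x) + long_advantage h w) \<partial>std_gaussian)"
    unfolding bias_difference[OF assms, symmetric]
    using int by (simp add: long_advantage_def continuation_value_def)
qed

lemma abs_long_advantage_le:
  assumes "bias_function \<rho>0 \<rho>1 c h" "c \<ge> 0"
  shows "\<bar>long_advantage h x\<bar> \<le> c"
proof -
  interpret prob_space std_gaussian by (rule prob_space_std_gaussian)
  note fp = long_advantage_fixed_point[OF assms, of x]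
  have "\<bar>long_advantage h x\<bar>
      \<le> (\<integral>w. \<bar>clamp_cost c (2 * (\<rho>0 * w + \<rho>1 * x) + long_advantage h w)\<bar> \<partial>std_gaussian)"
    unfolding fp(2) by (rule integral_abs_bound)
  also have "\<dots> \<le> (\<integral>w. c \<partial>std_gaussian)"
    using fp(1) assms(2) by (intro integral_mono) (auto simp: clamp_cost_def)
  finally show ?thesis using prob_space by simp
qed

text \<open>Since \<open>\<bar>long_advantage h w\<bar> \<le> c\<close>, the cut-off is active with the sign of \<open>\<rho>0 * w + \<rho>1 * x\<close>
  as soon as the absolute value of the latter exceeds \<open>c\<close>. On the remaining ball of radius \<open>c / \<rho>0\<close>,
  whose probability is at most \<open>2 * c / \<rho>0\<close>, the error is at most \<open>2 * c\<close>.\<close>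

lemma long_advantage_expansion:
  assumes bias: "bias_function \<rho>0 \<rho>1 c h" and c: "c \<ge> 0" and rho: "\<rho>0 > 0"
  shows "\<bar>long_advantage h x - c * (\<integral>w. sgn (w + \<rho>1 / \<rho>0 * x) \<partial>std_gaussian)\<bar> \<le> 4 / \<rho>0 * c\<^sup>2"
proof -
  interpret prob_space std_gaussian by (rule prob_space_std_gaussian)
  define a where "a = \<rho>1 / \<rho>0 * x"
  let ?k = "\<lambda>w. clamp_cost c (2 * (\<rho>0 * w + \<rho>1 * x) + long_advantage h w)"
  let ?B = "cball (- a) (c / \<rho>0)"
  note fp = long_advantage_fixed_point[OF bias c, of x]
  have intd: "integrable std_gaussian (\<lambda>w. ?k w - c * sgn (w + a))"
    using integrable_std_gaussian_sgn[of 1 a] fp(1) by simp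
  have close: "\<bar>?k w - c * sgn (w + a)\<bar> \<le> 2 * c * indicator ?B w" for w
  proof (cases "w \<in> ?B")
    case True
    then show ?thesis using c by (auto simp: clamp_cost_def sgn_if)
  next
    case False
    have eq: "\<rho>0 * w + \<rho>1 * x = \<rho>0 * (w + a)"
      using rho by (simp add: a_def field_simps)
    from False have "c / \<rho>0 < \<bar>w + a\<bar>" by (simp add: dist_real_def abs_if split: if_splits)
    then have "c < \<rho>0 * \<bar>w + a\<bar>" using rho by (simp add: field_simps)
    also have "\<dots> = \<bar>\<rho>0 * (w + a)\<bar>" using rho by (simp add: abs_mult)
    finally have far: "c < \<bar>\<rho>0 * (w + a)\<bar>" .
    have K: "\<bar>long_advantage h w\<bar> \<le> c" by (rule abs_long_advantage_le[OF bias c])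
    show ?thesis
    proof (cases "w + a > 0")
      case True
      then have "\<rho>0 * (w + a) > 0" using rho by simp
      then show ?thesis using far K c True False unfolding eq clamp_cost_def by simp
    next
      case neg: False
      then have "\<rho>0 * (w + a) \<le> 0" using rho by (simp add: mult_le_0_iff)
      moreover from this have "w + a < 0" using far c neg by (cases "w + a = 0") auto
      ultimately show ?thesis using far K c False unfolding eq clamp_cost_def by simp
    qed
  qed
  have "\<bar>long_advantage h x - c * (\<integral>w. sgn (w + a) \<partial>std_gaussian)\<bar>
      = \<bar>\<integral>w. ?k w - c * sgn (w + a) \<partial>std_gaussian\<bar>"
    using fp integrable_std_gaussian_sgn[of 1 a] by simp
  also have "\<dots> \<le> (\<integral>w. \<bar>?k w - c * sgn (w + a)\<bar> \<partial>std_gaussian)"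
    by (rule integral_abs_bound)
  also have "\<dots> \<le> (\<integral>w. 2 * c * indicator ?B w \<partial>std_gaussian)"
    using intd close by (intro integral_mono integrable_abs)
      (auto intro!: integrable_real_indicator simp: less_top[symmetric])
  also have "\<dots> = 2 * c * measure std_gaussian ?B"
    by simp
  also have "\<dots> \<le> 2 * c * (2 * (c / \<rho>0))"
    using c rho by (intro mult_left_mono measure_std_gaussian_cball_le) auto
  finally show ?thesis
    by (simp add: a_def power2_eq_square)
qed

text \<open>The Bellman equation leaves the decision open only at the single value of \<open>x1\<close> where both
  actions tie; everywhere else it is forced, so a threshold policy can only have its threshold
  at the tie.\<close>

lemma boundary_eq:
  assumes rho: "\<rho>1 > 0"
    and opt: "optimal_policy \<rho>0 \<rho>1 c h \<pi>"
    and G: "\<And>x1. \<pi> (x0, x1, 1) = 1 \<longleftrightarrow> x1 \<ge> G"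
  shows "G = - (\<rho>0 / \<rho>1) * x0 - c / (2 * \<rho>1) - long_advantage h x0 / (2 * \<rho>1)"
proof -
  define T where "T = - (\<rho>0 / \<rho>1) * x0 - c / (2 * \<rho>1) - long_advantage h x0 / (2 * \<rho>1)"
  have gain: "2 * \<rho>1 * (x1 - T) = 2 * (\<rho>0 * x0 + \<rho>1 * x1) + c + long_advantage h x0" for x1
    using rho by (simp add: T_def field_simps)
  have pos: "\<pi> (x0, x1, 1) = 1 \<or> \<pi> (x0, x1, 1) = - 1" for x1
  proof -
    have "(\<lambda>(x0, x1). \<pi> (x0, x1, 1)) \<in> borel \<rightarrow>\<^sub>M count_space positions"
      using opt by (auto simp: optimal_policy_def average_optimal_def policy_def positions_def)
    from measurable_space[OF this, of "(x0, x1)"] show ?thesis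
      by (auto simp: positions_def)
  qed
  have best: "action_value \<rho>0 \<rho>1 c h (x0, x1, 1) (\<pi> (x0, x1, 1))
      = max (\<rho>0 * x0 + \<rho>1 * x1 + continuation_value h x0 1)
            (- (\<rho>0 * x0 + \<rho>1 * x1) - c + continuation_value h x0 (- 1))" for x1
  proof -
    have "(x0, x1, 1) \<in> states" by (simp add: states_def positions_def)
    with opt have "action_value \<rho>0 \<rho>1 c h (x0, x1, 1) (\<pi> (x0, x1, 1))
        = Max (action_value \<rho>0 \<rho>1 c h (x0, x1, 1) ` positions)"
      unfolding optimal_policy_def by blast
    also have "\<dots> = max (\<rho>0 * x0 + \<rho>1 * x1 + continuation_value h x0 1)
            (- (\<rho>0 * x0 + \<rho>1 * x1) - c + continuation_value h x0 (- 1))"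
      by (simp add: positions_def action_value_eq)
    finally show ?thesis .
  qed
  have long: "G \<le> x1" if "T < x1" for x1
  proof -
    have "0 < 2 * \<rho>1 * (x1 - T)" using rho that by simp
    then have "\<pi> (x0, x1, 1) \<noteq> - 1"
      using best[of x1] unfolding gain long_advantage_def
      by (intro notI) (simp add: action_value_eq)
    then show ?thesis using pos[of x1] G by auto
  qed
  have short: "x1 < G" if "x1 < T" for x1
  proof -
    have "2 * \<rho>1 * (x1 - T) < 0" using rho that by (simp add: mult_less_0_iff)
    then have "\<pi> (x0, x1, 1) \<noteq> 1"
      using best[of x1] unfolding gain long_advantage_def
      by (intro notI) (simp add: action_value_eq)
    then show ?thesis using G[of x1] by auto
  qed
  have "G \<le> T" using long by (rule dense_ge)
  moreover have "T \<le> G" by (rule dense_le, rule less_imp_le, rule short)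
  ultimately show ?thesis by (simp add: T_def)
qed

section \<open>The frictionless problem\<close>

text \<open>Without switching cost the position carries no value, so the maximum is an absolute value plus
  the common continuation value. Substituting this expression for \<open>h\<close> in the definition of the
  continuation value determines the latter up to a constant.\<close>

lemma bias_frictionless:
  assumes bias: "bias_function \<rho>0 \<rho>1 0 h"
  obtains C where
    "\<And>x0 x1. h (x0, x1, 1) = \<bar>\<rho>0 * x0 + \<rho>1 * x1\<bar> + (\<integral>w. \<bar>\<rho>0 * w + \<rho>1 * x0\<bar> \<partial>std_gaussian) + C"
proof -
  interpret prob_space std_gaussian by (rule prob_space_std_gaussian)
  let ?V = "\<lambda>x. continuation_value h x 1"
  have "continuation_value h x (- 1) = ?V x" for x
    using abs_long_advantage_le[OF bias, of x] by (simp add: long_advantage_def)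
  then obtain g where g: "\<And>x0 x1. h (x0, x1, 1) + g
      = max (\<rho>0 * x0 + \<rho>1 * x1 + ?V x0) (- (\<rho>0 * x0 + \<rho>1 * x1) + ?V x0)"
    using bellman_equations[OF bias] by (metis diff_zero)
  have h: "h (x0, x1, 1) = \<bar>\<rho>0 * x0 + \<rho>1 * x1\<bar> + ?V x0 - g" for x0 x1
    using g[of x0 x1] by (simp add: max_def abs_if split: if_splits)
  have int_abs: "integrable std_gaussian (\<lambda>w. \<bar>\<rho>0 * w + \<rho>1 * x\<bar>)" for x
    by (rule integrable_abs[OF integrable_std_gaussian_affine])
  have int_h: "integrable std_gaussian (\<lambda>w. h (w, x, 1))" for x
    by (rule integrable_bias[OF bias]) (simp add: positions_def)
  have int_V: "integrable std_gaussian (\<lambda>w. ?V w - g)"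
    using Bochner_Integration.integrable_diff[OF int_h[of 0] int_abs[of 0]] by (simp add: h)
  have V: "?V x = (\<integral>w. \<bar>\<rho>0 * w + \<rho>1 * x\<bar> \<partial>std_gaussian) + (\<integral>w. ?V w - g \<partial>std_gaussian)" for x
  proof -
    have "?V x = (\<integral>w. \<bar>\<rho>0 * w + \<rho>1 * x\<bar> + (?V w - g) \<partial>std_gaussian)"
      unfolding continuation_value_def[of h x 1] by (simp add: h add_diff_eq)
    also have "\<dots> = (\<integral>w. \<bar>\<rho>0 * w + \<rho>1 * x\<bar> \<partial>std_gaussian) + (\<integral>w. ?V w - g \<partial>std_gaussian)"
      by (rule Bochner_Integration.integral_add[OF int_abs int_V])
    finally show ?thesis .
  qed
  show thesis
  proof (rule that)
    show "h (x0, x1, 1) = \<bar>\<rho>0 * x0 + \<rho>1 * x1\<bar> + (\<integral>w. \<bar>\<rho>0 * w + \<rho>1 * x0\<bar> \<partial>std_gaussian)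
        + ((\<integral>w. ?V w - g \<partial>std_gaussian) - g)" for x0 x1
      using h[of x0 x1] V[of x0] by simp
  qed
qed

text \<open>At the boundary \<open>x1 = - (\<rho>0 / \<rho>1) * x0\<close> the immediate reward vanishes, so \<open>H\<close> can be read off
  there; the condition \<open>H 0 = 0\<close> removes the constant of the bias.\<close>

lemma bias_part_frictionless:
  assumes rho: "\<rho>0 > 0" "\<rho>1 > 0"
    and bias: "bias_function \<rho>0 \<rho>1 0 h"
    and H: "\<And>x0 x1. x1 \<ge> - (\<rho>0 / \<rho>1) * x0 \<Longrightarrow> h (x0, x1, 1) = \<rho>1 * x1 + H x0"
    and H0: "H 0 = 0"
  shows "H x = \<rho>0 * x
       + \<rho>1 * x * (LBINT y = - (\<rho>1 / \<rho>0 * x)..\<rho>1 / \<rho>0 * x. std_normal_density y)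
       - 2 * \<rho>0 * (LBINT y = 0..\<rho>1 / \<rho>0 * x. y * std_normal_density y)"
proof -
  define a where "a = \<rho>1 / \<rho>0 * x"
  have a: "\<rho>0 * a = \<rho>1 * x" using rho by (simp add: a_def)
  obtain C where C: "\<And>x0 x1. h (x0, x1, 1)
      = \<bar>\<rho>0 * x0 + \<rho>1 * x1\<bar> + (\<integral>w. \<bar>\<rho>0 * w + \<rho>1 * x0\<bar> \<partial>std_gaussian) + C"
    using bias_frictionless[OF bias] by blast
  have HC: "H z = \<rho>0 * z + (\<integral>w. \<bar>\<rho>0 * w + \<rho>1 * z\<bar> \<partial>std_gaussian) + C" for z
    using H[of z "- (\<rho>0 / \<rho>1) * z"] C[of z "- (\<rho>0 / \<rho>1) * z"] rho by simp
  have "\<bar>\<rho>0 * w + \<rho>1 * x\<bar> = \<rho>0 * \<bar>w + a\<bar>" for w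
    using rho by (simp flip: a add: distrib_left[symmetric] abs_mult)
  moreover have "\<bar>\<rho>0 * w\<bar> = \<rho>0 * \<bar>w\<bar>" for w
    using rho by (simp add: abs_mult)
  ultimately have "H x - H 0
      = \<rho>0 * x + \<rho>0 * ((\<integral>w. \<bar>w + a\<bar> \<partial>std_gaussian) - (\<integral>w. \<bar>w\<bar> \<partial>std_gaussian))"
    by (simp add: HC right_diff_distrib)
  also have "\<dots> = \<rho>0 * x + (\<rho>0 * a) * (LBINT y = - a..a. std_normal_density y)
      - 2 * \<rho>0 * (LBINT y = 0..a. y * std_normal_density y)"
    unfolding expectation_abs by (simp add: algebra_simps)
  finally show ?thesis
    unfolding a H0 unfolding a_def by simp
qed

text \<open>Only the odd part \<open>\<rho>0 * y\<close> of the frictionless bias enters the slope, where it cancels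
  the remaining density term.\<close>

lemma boundary_slope_frictionless:
  fixes \<rho>0 \<rho>1 x :: real and H :: "real \<Rightarrow> real"
  assumes rho: "\<rho>0 > 0" "\<rho>1 > 0"
    and H: "\<And>x :: real. H x = \<rho>0 * x
       + \<rho>1 * x * (LBINT y = - (\<rho>1 / \<rho>0 * x)..\<rho>1 / \<rho>0 * x. std_normal_density y)
       - 2 * \<rho>0 * (LBINT y = 0..\<rho>1 / \<rho>0 * x. y * std_normal_density y)"
  shows "boundary_slope \<rho>0 \<rho>1 H x
     = - 1 / (2 * \<rho>1) - 1 / (2 * \<rho>1) * (\<integral>w. sgn (w + \<rho>1 / \<rho>0 * x) \<partial>std_gaussian)"
proof -
  define y where "y = \<rho>1 / \<rho>0 * x"
  have "H y - H (- y) = 2 * \<rho>0 * y"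
    unfolding H
    using interval_integral_std_normal_odd[of "\<rho>1 / \<rho>0 * y"]
      interval_integral_id_std_normal_even[of "\<rho>1 / \<rho>0 * y"]
    by simp
  also have "\<dots> = 2 * \<rho>1 * x" using rho by (simp add: y_def)
  finally show ?thesis
    using rho unfolding boundary_slope_def expectation_sgn y_def[symmetric]
    by (simp add: field_simps)
qed

section \<open>First-order expansion of the boundary\<close>

theorem mainTheorem2:
  fixes \<rho>0 \<rho>1 :: real
    and h :: "real \<Rightarrow> state \<Rightarrow> real"
    and \<pi> :: "real \<Rightarrow> state \<Rightarrow> int"
    and G H :: "real \<Rightarrow> real \<Rightarrow> real"
  assumes rho: "\<rho>0 > 0" "\<rho>1 > 0"
    and bias: "\<And>c. c \<ge> 0 \<Longrightarrow> bias_function \<rho>0 \<rho>1 c (h c)"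
    and opt: "\<And>c. c \<ge> 0 \<Longrightarrow> optimal_policy \<rho>0 \<rho>1 c (h c) (\<pi> c)"
    and G: "\<And>c x0 x1. c \<ge> 0 \<Longrightarrow> \<pi> c (x0, x1, 1) = 1 \<longleftrightarrow> x1 \<ge> G x0 c"
    and H: "\<And>c x0 x1. c \<ge> 0 \<Longrightarrow> x1 \<ge> G x0 c \<Longrightarrow> h c (x0, x1, 1) = \<rho>1 * x1 + H x0 c"
    \<comment> \<open>fixes the free additive constant of the bias; \<open>- c / (2 * \<rho>1)\<close> is \<open>G 0 c\<close>\<close>
    and normalization: "\<And>c. c \<ge> 0 \<Longrightarrow> H (- (c / (2 * \<rho>1))) c = 0"
  shows "\<forall>x.
     ((\<lambda>c. G x c) has_real_derivative boundary_slope \<rho>0 \<rho>1 (\<lambda>y. H y 0) x) (at 0 within {0..})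
   \<and> (\<lambda>c. G x c - (- (\<rho>0 / \<rho>1) * x + boundary_slope \<rho>0 \<rho>1 (\<lambda>y. H y 0) x * c))
        \<in> o[at_right 0](\<lambda>c. c)
   \<and> H x 0 = \<rho>0 * x
       + \<rho>1 * x * (LBINT y = - (\<rho>1 / \<rho>0 * x)..\<rho>1 / \<rho>0 * x. std_normal_density y)
       - 2 * \<rho>0 * (LBINT y = 0..\<rho>1 / \<rho>0 * x. y * std_normal_density y)"
proof -
  have G_eq: "G x c = - (\<rho>0 / \<rho>1) * x - c / (2 * \<rho>1) - long_advantage (h c) x / (2 * \<rho>1)"
    if "c \<ge> 0" for x c
    by (rule boundary_eq[OF rho(2) opt[OF that]]) (rule G[OF that])
  have G0: "G x 0 = - (\<rho>0 / \<rho>1) * x" for x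
    using G_eq[of 0 x] abs_long_advantage_le[OF bias, of 0 x] by simp
  have H0: "H x 0 = \<rho>0 * x
       + \<rho>1 * x * (LBINT y = - (\<rho>1 / \<rho>0 * x)..\<rho>1 / \<rho>0 * x. std_normal_density y)
       - 2 * \<rho>0 * (LBINT y = 0..\<rho>1 / \<rho>0 * x. y * std_normal_density y)" for x
    using rho bias[OF order_refl]
  proof (rule bias_part_frictionless)
    show "h 0 (x0, x1, 1) = \<rho>1 * x1 + H x0 0" if "x1 \<ge> - (\<rho>0 / \<rho>1) * x0" for x0 x1
      using H[of 0 x0 x1] that by (simp add: G0)
    show "H 0 0 = 0" using normalization[of 0] by simp
  qed
  define slope where "slope = boundary_slope \<rho>0 \<rho>1 (\<lambda>y. H y 0)"
  have remainder: "\<bar>G x c - (- (\<rho>0 / \<rho>1) * x + slope x * c)\<bar> \<le> 2 / (\<rho>0 * \<rho>1) * c\<^sup>2"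
    if c: "c \<ge> 0" for x c
  proof -
    let ?m = "\<integral>w. sgn (w + \<rho>1 / \<rho>0 * x) \<partial>std_gaussian"
    have "G x c - (- (\<rho>0 / \<rho>1) * x + slope x * c) = - (long_advantage (h c) x - c * ?m) / (2 * \<rho>1)"
      unfolding G_eq[OF c] slope_def boundary_slope_frictionless[of \<rho>0 \<rho>1 "\<lambda>y. H y 0", OF rho H0]
      using rho by (simp add: field_simps)
    also have "\<bar>\<dots>\<bar> = \<bar>long_advantage (h c) x - c * ?m\<bar> / (2 * \<rho>1)"
      using rho by simp
    also have "\<dots> \<le> 4 / \<rho>0 * c\<^sup>2 / (2 * \<rho>1)"
      using rho by (intro divide_right_mono long_advantage_expansion[OF bias[OF c] c rho(1)]) simp
    finally show ?thesis by (simp add: mult_ac)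
  qed
  have quotient: "((\<lambda>c. (G x c - (- (\<rho>0 / \<rho>1) * x + slope x * c)) / c) \<longlongrightarrow> 0) (at_right 0)" for x
  proof (rule Lim_null_comparison)
    show "\<forall>\<^sub>F c in at_right 0. norm ((G x c - (- (\<rho>0 / \<rho>1) * x + slope x * c)) / c)
        \<le> 2 / (\<rho>0 * \<rho>1) * c"
      using eventually_at_right_less[of 0]
    proof eventually_elim
      case (elim c)
      then show ?case
        using divide_right_mono[OF remainder[of c x], of c]
        by (simp add: power2_eq_square)
    qed
    show "((\<lambda>c. 2 / (\<rho>0 * \<rho>1) * c) \<longlongrightarrow> 0) (at_right 0)"
      using rho by (auto intro!: tendsto_eq_intros)
  qed
  have deriv: "((\<lambda>c. G x c) has_real_derivative slope x) (at 0 within {0..})" for x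
  proof -
    have "((\<lambda>c. (G x c - (- (\<rho>0 / \<rho>1) * x + slope x * c)) / c + slope x) \<longlongrightarrow> 0 + slope x)
        (at_right 0)"
      by (intro tendsto_add quotient tendsto_const)
    moreover have "\<forall>\<^sub>F c in at_right 0. (G x c - (- (\<rho>0 / \<rho>1) * x + slope x * c)) / c + slope x
        = (G x c - G x 0) / (c - 0)"
      using eventually_at_right_less[of 0]
      by eventually_elim (simp add: G0 diff_divide_distrib add_divide_distrib)
    ultimately have "((\<lambda>c. (G x c - G x 0) / (c - 0)) \<longlongrightarrow> 0 + slope x) (at_right 0)"
      by (rule Lim_transform_eventually)
    then show ?thesis
      by (simp add: has_field_derivative_iff at_within_Ici_at_right)
  qed
  have small: "(\<lambda>c. G x c - (- (\<rho>0 / \<rho>1) * x + slope x * c)) \<in> o[at_right 0](\<lambda>c. c)" for x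
    by (rule smalloI_tendsto[OF quotient])
       (use eventually_at_right_less[of 0] in eventually_elim, simp)
  show ?thesis
    using deriv small H0 unfolding slope_def by blast
qed

end
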